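(* Let $(\alpha,\beta)$ be one of the pairs $$(8,56),\ (9,26),\ (10,18),\ (11,15),\ (12,13),\ (13,12),\ (14,11),\ (15,10),\ (17,9),\ (20,8),\ (27,7),\ (52,6).$$ Let $d$ be a positive integer and let $G$ be a $d$-degenerate graph with maximum degree at most $\Delta$ and order $n\geq \beta\Delta$. Then for every integer $k\geq \alpha d$, the graph $G$ admits an equitable tree-$k$-coloring.
   Context: All graphs are finite and simple. A graph $G$ is $d$-degenerate if every subgraph of $G$ contains a vertex of degree at most $d$. A tree-$k$-coloring of $G$ is a function $c:V(G)\to\{1,2,\dots,k\}$ such that for each $1\le i\le k$ the color class $c^{-1}(i)$ induces a forest in $G$. A tree-$k$-coloring $c$ is equitable if $\big||c^{-1}(i)|-|c^{-1}(j)|\big|\le 1$ for all $1\le i,j\le k$ (equivalently, every color class has at most $\lceil |V(G)|/k\rceil$ vertices). *)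

theory Defs
  imports "Graph_Theory.Graph_Theory"
begin

text \<open>
  A finite simple graph is a \<^locale>\<open>pair_graph\<close>: a finite, loop-free, symmetric digraph
  whose arcs are pairs of vertices, so that every undirected edge is a pair of opposite arcs. The
  degree of a vertex is then its \<^const>\<open>out_degree\<close>.
\<close>

text \<open>
  The subgraphs \<open>H\<close> have to be symmetric again. The empty one has no vertex at all and
  is excluded.
\<close>

definition degenerate :: "nat \<Rightarrow> 'a pair_pre_digraph \<Rightarrow> bool" where
  "degenerate d G \<longleftrightarrow>
     (\<forall>H. pair_graph H \<and> subgraph (with_proj H) (with_proj G) \<and> pverts H \<noteq> {} \<longrightarrow>
        (\<exists>v\<in>pverts H. out_degree (with_proj H) v \<le> d))"

text \<open>
  In a symmetric digraph every edge \<open>uv\<close> gives a \<^const>\<open>pre_digraph.cycle\<close> \<open>u, v, u\<close> of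
  length 2. Only those of length at least 3 are cycles of the undirected graph, hence
  \<^const>\<open>forest\<close> of the library is not suitable here.
\<close>

definition undirected_forest :: "('a, 'b) pre_digraph \<Rightarrow> bool" where
  "undirected_forest G \<longleftrightarrow> \<not> (\<exists>p. pre_digraph.cycle G p \<and> 3 \<le> length p)"

definition color_class :: "'a pair_pre_digraph \<Rightarrow> ('a \<Rightarrow> nat) \<Rightarrow> nat \<Rightarrow> 'a set" where
  "color_class G c i = {v \<in> pverts G. c v = i}"

definition tree_coloring :: "'a pair_pre_digraph \<Rightarrow> nat \<Rightarrow> ('a \<Rightarrow> nat) \<Rightarrow> bool" where
  "tree_coloring G k c \<longleftrightarrow>
     (\<forall>v\<in>pverts G. c v \<in> {1..k}) \<and>
     (\<forall>i\<in>{1..k}. undirected_forest (with_proj G \<restriction> color_class G c i))"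

definition equitable_tree_coloring :: "'a pair_pre_digraph \<Rightarrow> nat \<Rightarrow> ('a \<Rightarrow> nat) \<Rightarrow> bool" where
  "equitable_tree_coloring G k c \<longleftrightarrow>
     tree_coloring G k c \<and>
     (\<forall>i\<in>{1..k}. \<forall>j\<in>{1..k}.
        \<bar>int (card (color_class G c i)) - int (card (color_class G c j))\<bar> \<le> 1)"

end

theory Submission
  imports Defs
begin

text \<open>
  Order the vertices so that each has at most \<open>d\<close> earlier neighbours, and colour them one by one.
  A vertex may join every class that contains at most one of its neighbours, so that all classes
  stay 1-degenerate and hence acyclic. When every class admitting the new vertex \<open>v\<close> is full,
  one vertex \<open>x\<close> of such a class moves to a non-full class \<open>X\<^sub>0\<close> and \<open>v\<close> takes its place.

  Such an \<open>x\<close> exists if few vertices have two neighbours in \<open>X\<^sub>0\<close>, so the number of edges at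
  \<open>X\<^sub>0\<close> must be under control. The weight of a vertex is the number of its later neighbours;
  all weights together are at most \<open>d n\<close>. The vertices of weight above \<open>2k/5\<close> are big, and the
  invariant is that the big vertices of each class weigh at most \<open>2n/5 + \<Delta>\<close>. Hence only classes
  whose big vertices weigh at most \<open>2n/5\<close> are allowed to receive \<open>v\<close>, and only an \<open>x\<close> that
  is not big is moved. Overweight classes and big vertices elsewhere draw on the same budget
  \<open>d n\<close>, which leaves enough candidates for \<open>x\<close>.
\<close>

section \<open>Degeneracy of vertex sets and degeneracy orders\<close>

definition deg_in :: "('a \<Rightarrow> 'a \<Rightarrow> bool) \<Rightarrow> 'a set \<Rightarrow> 'a \<Rightarrow> nat" where
  "deg_in E T v = card {u \<in> T. E v u}"

text \<open>Degeneracy of the subgraph induced by \<open>X\<close>, phrased with vertex sets only.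
  For a finite class of a simple graph, the case \<open>d = 1\<close> means that the class induces a
  forest.\<close>

definition sparse :: "('a \<Rightarrow> 'a \<Rightarrow> bool) \<Rightarrow> nat \<Rightarrow> 'a set \<Rightarrow> bool" where
  "sparse E d X \<longleftrightarrow> (\<forall>T\<subseteq>X. T \<noteq> {} \<longrightarrow> (\<exists>v\<in>T. deg_in E T v \<le> d))"

lemma deg_in_mono: "finite Y \<Longrightarrow> X \<subseteq> Y \<Longrightarrow> deg_in E X v \<le> deg_in E Y v"
  unfolding deg_in_def by (rule card_mono) auto

lemma sparse_subset: "sparse E d X \<Longrightarrow> Y \<subseteq> X \<Longrightarrow> sparse E d Y"
  unfolding sparse_def by (meson subset_trans)

lemma sparse_insert:
  assumes "finite X" "sparse E d X" "deg_in E X v \<le> d" "\<not> E v v"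
  shows "sparse E d (insert v X)"
  unfolding sparse_def
proof (intro allI impI)
  fix T assume T: "T \<subseteq> insert v X" "T \<noteq> {}"
  show "\<exists>v\<in>T. deg_in E T v \<le> d"
  proof (cases "v \<in> T")
    case True
    have "{u \<in> T. E v u} \<subseteq> {u \<in> X. E v u}"
      using T(1) assms(4) by auto
    then have "deg_in E T v \<le> deg_in E X v"
      unfolding deg_in_def using assms(1) by (intro card_mono) auto
    then show ?thesis using True assms(3) by (meson le_trans)
  next
    case False
    then have "T \<subseteq> X" using T(1) by auto
    then show ?thesis using assms(2) T(2) unfolding sparse_def by blast
  qed
qed

lemma sum_deg_in_swap:
  assumes "finite A" "finite B" "\<And>u v. E u v \<Longrightarrow> E v u"
  shows "(\<Sum>a\<in>A. deg_in E B a) = (\<Sum>b\<in>B. deg_in E A b)"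
proof -
  have "(\<Sum>a\<in>A. deg_in E B a) = (\<Sum>a\<in>A. \<Sum>b\<in>B. if E a b then 1 else 0)"
    unfolding deg_in_def using assms(2) by (simp add: sum.If_cases Int_def)
  also have "\<dots> = (\<Sum>b\<in>B. \<Sum>a\<in>A. if E a b then 1 else 0)"
    by (rule sum.swap)
  also have "\<dots> = (\<Sum>b\<in>B. \<Sum>a\<in>A. if E b a then 1 else 0)"
    using assms(3) by (intro sum.cong refl) auto
  also have "\<dots> = (\<Sum>b\<in>B. deg_in E A b)"
    unfolding deg_in_def using assms(1) by (simp add: sum.If_cases Int_def)
  finally show ?thesis .
qed

text \<open>The Markov-type estimate behind every count in \<open>movable_exists\<close>.\<close>

lemma mult_card_le_sum:
  fixes f :: "'b \<Rightarrow> nat"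
  assumes "finite A" "B \<subseteq> A" "\<And>x. x \<in> B \<Longrightarrow> m \<le> f x"
  shows "m * card B \<le> sum f A"
proof -
  have "m * card B \<le> sum f B"
    using sum_bounded_below[of B m f] assms(3) by (simp add: mult.commute)
  also have "\<dots> \<le> sum f A" using assms by (intro sum_mono2) auto
  finally show ?thesis .
qed

text \<open>Peel off a vertex of degree at most \<open>d\<close>, order the rest by induction and
  put the peeled vertex last. The ranks of the others, and hence their sets of earlier vertices, do
  not change.\<close>

lemma sparse_imp_rank:
  assumes "finite V" "sparse E d V"
  shows "\<exists>rank. bij_betw rank V {..<card V} \<and>
           (\<forall>v\<in>V. deg_in E {u \<in> V. rank u < rank v} v \<le> d)"
  using assms
proof (induction "card V" arbitrary: V)
  case 0
  then show ?case by (auto simp: bij_betw_def)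
next
  case (Suc m)
  then have "V \<noteq> {}" by auto
  then obtain v where v: "v \<in> V" "deg_in E V v \<le> d"
    using Suc.prems(2) unfolding sparse_def by blast
  define W where "W = V - {v}"
  have W: "card W = m" "finite W" "V = insert v W" "v \<notin> W"
    using Suc v by (auto simp: W_def)
  obtain rank where r: "bij_betw rank W {..<m}"
      "\<And>w. w \<in> W \<Longrightarrow> deg_in E {u \<in> W. rank u < rank w} w \<le> d"
    using Suc.hyps(1)[of W] W Suc.prems(2) sparse_subset[of E d V W] by auto
  define rank' where "rank' = rank(v := m)"
  have same: "rank' w = rank w" if "w \<in> W" for w
    using that W(4) by (auto simp: rank'_def)
  have less: "rank w < m" if "w \<in> W" for w
    using bij_betwE[OF r(1)] that by auto
  have "bij_betw rank' W {..<m}"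
    using r(1) same by (simp cong: bij_betw_cong)
  then have "bij_betw rank' (insert v W) (insert (rank' v) {..<m})"
    by (intro notIn_Un_bij_betw[where A = W and A' = "{..<m}", simplified])
       (auto simp: W(4) rank'_def)
  moreover have "insert (rank' v) {..<m} = {..<card V}"
    using Suc.hyps(2) by (auto simp: rank'_def)
  ultimately have "bij_betw rank' V {..<card V}" using W(3) by simp
  moreover have "deg_in E {u \<in> V. rank' u < rank' w} w \<le> d" if "w \<in> V" for w
  proof (cases "w = v")
    case True
    have "deg_in E {u \<in> V. rank' u < rank' w} v \<le> deg_in E V v"
      using Suc.prems(1) by (intro deg_in_mono) auto
    then show ?thesis using v(2) True by simp
  next
    case False
    then have w: "w \<in> W" using that W(3) by auto
    have "{u \<in> V. rank' u < rank' w} = {u \<in> W. rank u < rank w}"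
      using W(3,4) same less[OF w] w by (auto simp: rank'_def)
    then show ?thesis using r(2)[OF w] by simp
  qed
  ultimately show ?case by blast
qed

section \<open>Colour classes and the weighted setting\<close>

definition cls :: "'a set \<Rightarrow> ('a \<Rightarrow> nat) \<Rightarrow> nat \<Rightarrow> 'a set" where
  "cls S c i = {v \<in> S. c v = i}"

lemma sum_card_cls:
  assumes "finite S" "c ` S \<subseteq> {1..k}"
  shows "(\<Sum>i\<in>{1..k}. card (cls S c i)) = card S"
proof -
  have "card (\<Union>i\<in>{1..k}. cls S c i) = (\<Sum>i\<in>{1..k}. card (cls S c i))"
    using assms(1) by (intro card_UN_disjoint) (auto simp: cls_def)
  moreover have "(\<Union>i\<in>{1..k}. cls S c i) = S"
    using assms(2) by (auto simp: cls_def)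
  ultimately show ?thesis by simp
qed

text \<open>
  The numeric assumption \<open>room\<close> is what the count in \<open>movable_exists\<close> below needs when the
  non-full class has at most \<open>q\<close> vertices and the full ones have at least \<open>q + 1\<close>.
\<close>

locale ranked_graph =
  fixes V :: "'a set" and E :: "'a \<Rightarrow> 'a \<Rightarrow> bool" and rank :: "'a \<Rightarrow> nat" and d k D :: nat
  assumes finite_V: "finite V"
    and sym: "E u v \<Longrightarrow> E v u"
    and irrefl: "\<not> E v v"
    and rank_bij: "bij_betw rank V {..<card V}"
    and back_deg: "v \<in> V \<Longrightarrow> deg_in E {u \<in> V. rank u < rank v} v \<le> d"
    and max_deg: "v \<in> V \<Longrightarrow> deg_in E V v \<le> D"
    and k_pos: "0 < k"
    and room: "1 \<le> q \<Longrightarrow> card V \<le> (q + 2) * k \<Longrightarrow> 5 * ((7 * q + 11) * d + D) < 6 * (q + 1) * k"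
begin

abbreviation n :: nat where "n \<equiv> card V"

definition fwd :: "'a \<Rightarrow> nat" where
  "fwd v = deg_in E {u \<in> V. rank v < rank u} v"

abbreviation big :: "'a \<Rightarrow> bool" where
  "big v \<equiv> 2 * k < 5 * fwd v"

definition load :: "'a set \<Rightarrow> nat" where
  "load X = sum fwd {x \<in> X. big x}"

definition admissible :: "'a set \<Rightarrow> ('a \<Rightarrow> nat) \<Rightarrow> bool" where
  "admissible S c \<longleftrightarrow> c ` S \<subseteq> {1..k} \<and>
     (\<forall>i\<in>{1..k}. sparse E 1 (cls S c i) \<and> 5 * load (cls S c i) \<le> 2 * n + 5 * D)"

section \<open>Weights and edge counts\<close>

lemma fwd_le:
  assumes "v \<in> V"
  shows "fwd v \<le> D"
proof -
  have "fwd v \<le> deg_in E V v"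
    unfolding fwd_def using finite_V by (intro deg_in_mono) auto
  then show ?thesis using max_deg[OF assms] by linarith
qed

text \<open>The left side counts each edge at its earlier end. Counted at its later end instead,
  each vertex contributes at most \<open>d\<close>.\<close>

lemma sum_fwd_le: "sum fwd V \<le> d * n"
proof -
  let ?B = "\<lambda>v. deg_in E {u \<in> V. rank u < rank v} v"
  have fwd: "fwd v = deg_in (\<lambda>u w. E u w \<and> rank u < rank w) V v" for v
    unfolding fwd_def deg_in_def by (rule arg_cong[where f = card]) auto
  have "sum fwd V = (\<Sum>v\<in>V. \<Sum>u\<in>V. if E v u \<and> rank v < rank u then 1 else 0)"
    unfolding fwd deg_in_def using finite_V by (simp add: sum.If_cases Int_def)
  also have "\<dots> = (\<Sum>u\<in>V. \<Sum>v\<in>V. if E v u \<and> rank v < rank u then 1 else 0)"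
    by (rule sum.swap)
  also have "\<dots> = (\<Sum>u\<in>V. \<Sum>v\<in>V. if E u v \<and> rank v < rank u then 1 else 0)"
    using sym by (intro sum.cong refl) auto
  also have "\<dots> = sum ?B V"
    unfolding deg_in_def using finite_V
    by (simp add: sum.If_cases Int_def conj_ac)
  also have "\<dots> \<le> d * n"
    using sum_bounded_above[of V ?B d] back_deg by (simp add: mult.commute)
  finally show ?thesis .
qed

lemma load_mono: "finite Y \<Longrightarrow> X \<subseteq> Y \<Longrightarrow> load X \<le> load Y"
  unfolding load_def by (rule sum_mono2) auto

text \<open>This is the slack \<open>D\<close> in \<open>admissible\<close>: a class of load at most
  2n/5 can take any vertex, even a big one.\<close>

lemma load_insert_le:
  assumes "finite X" "v \<in> V"
  shows "load (insert v X) \<le> load X + D"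
proof -
  have "load (insert v X) \<le> load X + fwd v"
  proof (cases "v \<in> X \<or> \<not> big v")
    case True
    then have "{x \<in> insert v X. big x} = {x \<in> X. big x}" by auto
    then show ?thesis by (simp add: load_def)
  next
    case False
    then have "{x \<in> insert v X. big x} = insert v {x \<in> X. big x}" by auto
    then show ?thesis using False assms(1) by (simp add: load_def)
  qed
  then show ?thesis using fwd_le[OF assms(2)] by linarith
qed

lemma load_insert_small: "\<not> big v \<Longrightarrow> load (insert v X) = load X"
  unfolding load_def by (rule arg_cong[where f = "sum fwd"]) auto

lemma deg_le_fwd:
  assumes "u \<in> V" "S \<subseteq> V"
  shows "deg_in E S u \<le> fwd u + d"
proof -
  let ?F = "{w \<in> {w \<in> V. rank u < rank w}. E u w}"
  let ?B = "{w \<in> {w \<in> V. rank w < rank u}. E u w}"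
  have "w \<in> ?F \<union> ?B" if "w \<in> S" "E u w" for w
  proof -
    have "w \<in> V" "w \<noteq> u" using that assms(2) irrefl by auto
    then have "rank w \<noteq> rank u"
      using rank_bij assms(1) by (auto simp: bij_betw_def dest: inj_onD)
    then show ?thesis using \<open>w \<in> V\<close> that(2) by auto
  qed
  then have "card {w \<in> S. E u w} \<le> card (?F \<union> ?B)"
    using finite_V by (intro card_mono) auto
  also have "\<dots> \<le> card ?F + card ?B" by (rule card_Un_le)
  also have "\<dots> \<le> fwd u + d"
    using back_deg[OF assms(1)] unfolding fwd_def deg_in_def by simp
  finally show ?thesis unfolding deg_in_def .
qed

text \<open>Every vertex has at most \<open>d\<close> earlier neighbours. The later neighbours of
  big vertices are charged to the load; any other vertex has at most 2k/5 of them. The factor 5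
  clears the fraction.\<close>

lemma sum_deg_le:
  assumes "X \<subseteq> V" "S \<subseteq> V"
  shows "5 * (\<Sum>u\<in>X. deg_in E S u) \<le> 5 * load X + (2 * k + 5 * d) * card X"
proof -
  have fin: "finite X" using assms(1) finite_V by (rule finite_subset)
  have "5 * (\<Sum>u\<in>X. deg_in E S u) = (\<Sum>u\<in>X. 5 * deg_in E S u)"
    by (simp add: sum_distrib_left)
  also have "\<dots> \<le> (\<Sum>u\<in>X. (if big u then 5 * fwd u else 0) + (2 * k + 5 * d))"
  proof (rule sum_mono)
    fix u assume "u \<in> X"
    then have "deg_in E S u \<le> fwd u + d" using deg_le_fwd assms by auto
    then show "5 * deg_in E S u \<le> (if big u then 5 * fwd u else 0) + (2 * k + 5 * d)"
      by (cases "big u") auto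
  qed
  also have "\<dots> = 5 * load X + (2 * k + 5 * d) * card X"
    using fin by (simp add: sum.distrib load_def sum.If_cases Int_def sum_distrib_left mult.commute)
  finally show ?thesis .
qed

section \<open>The exchange step\<close>

text \<open>Otherwise every vertex of the classes in \<open>L\<close> is big (\<open>M\<close>) or
  has two neighbours in class \<open>i0\<close> (\<open>R\<close>). The classes outside
  \<open>L\<close> are blocked by neighbours of \<open>v\<close> (\<open>B\<close>) or overweight
  (\<open>H\<close>). Bounds on all four sets leave too few classes to make up
  \<open>k\<close>.\<close>

lemma movable_exists:
  assumes S: "S \<subseteq> V" and adm: "admissible S c" and i0: "i0 \<in> {1..k}"
    and q: "1 \<le> q" "card (cls S c i0) \<le> q" "n \<le> (q + 2) * k"
    and v: "deg_in E S v \<le> d" and n_pos: "0 < n"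
    and L: "L = {i \<in> {1..k}. deg_in E (cls S c i) v \<le> 1 \<and> 5 * load (cls S c i) \<le> 2 * n}"
    and full: "\<And>i. i \<in> L \<Longrightarrow> q + 1 \<le> card (cls S c i)"
  shows "\<exists>i\<in>L. \<exists>x\<in>cls S c i. \<not> big x \<and> deg_in E (cls S c i0) x \<le> 1"
proof (rule ccontr)
  assume stuck: "\<not> ?thesis"
  have fS: "finite S" using S finite_V by (rule finite_subset)
  have fcls: "finite (cls S c i)" for i using fS by (simp add: cls_def)
  have range: "c ` S \<subseteq> {1..k}" using adm by (simp add: admissible_def)
  define B where "B = {i \<in> {1..k}. 2 \<le> deg_in E (cls S c i) v}"
  define H where "H = {i \<in> {1..k}. 2 * n < 5 * load (cls S c i)}"
  define U where "U = (\<Union>i\<in>L. cls S c i)"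
  define M where "M = {x \<in> U. big x}"
  define R where "R = {x \<in> S. 2 \<le> deg_in E (cls S c i0) x}"
  have fin: "finite L" "finite B" "finite H" "finite R"
    using fS by (auto simp: L B_def H_def R_def)
  have finU: "finite U" "finite M" using fin fcls by (auto simp: U_def M_def)
  note fin = fin finU

  \<comment> \<open>Each class in \<open>B\<close> uses up two of the at most \<open>d\<close>
    neighbours of \<open>v\<close> in \<open>S\<close>.\<close>
  have "2 * card B \<le> (\<Sum>i\<in>{1..k}. deg_in E (cls S c i) v)"
    by (rule mult_card_le_sum) (auto simp: B_def)
  also have "\<dots> = (\<Sum>i\<in>{1..k}. card (cls {u \<in> S. E v u} c i))"
    unfolding deg_in_def by (intro sum.cong refl arg_cong[where f = card]) (auto simp: cls_def)
  also have "\<dots> = deg_in E S v"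
    unfolding deg_in_def using fS range by (intro sum_card_cls) auto
  finally have B: "2 * card B \<le> d" using v by linarith

  have "{1..k} \<subseteq> L \<union> B \<union> H" by (auto simp: L B_def H_def)
  then have "card {1..k} \<le> card (L \<union> B \<union> H)"
    using fin by (intro card_mono) auto
  also have "\<dots> \<le> card L + card B + card H"
    by (meson add_le_mono1 card_Un_le le_trans)
  finally have cover: "k \<le> card L + card B + card H" by simp

  have "(q + 1) * card L \<le> (\<Sum>i\<in>L. card (cls S c i))"
    by (rule mult_card_le_sum) (use fin full in auto)
  also have "\<dots> = card U"
    unfolding U_def using fin fcls by (intro card_UN_disjoint[symmetric]) (auto simp: cls_def)
  also have "\<dots> \<le> card (M \<union> R)"
  proof (rule card_mono)
    show "U \<subseteq> M \<union> R"
    proof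
      fix x assume x: "x \<in> U"
      then obtain i where i: "i \<in> L" "x \<in> cls S c i" by (auto simp: U_def)
      then have "big x \<or> 2 \<le> deg_in E (cls S c i0) x" using stuck by fastforce
      then show "x \<in> M \<union> R" using x i by (auto simp: M_def R_def cls_def)
    qed
  qed (use fin in auto)
  also have "\<dots> \<le> card M + card R" by (rule card_Un_le)
  finally have L_le: "(q + 1) * card L \<le> card M + card R" .

  \<comment> \<open>Each vertex of \<open>R\<close> sends two edges into class \<open>i0\<close>, so
    the degree sum of that class bounds \<open>R\<close>.\<close>
  have "2 * card R \<le> (\<Sum>x\<in>S. deg_in E (cls S c i0) x)"
    by (rule mult_card_le_sum) (use fS in \<open>auto simp: R_def\<close>)
  also have "\<dots> = (\<Sum>u\<in>cls S c i0. deg_in E S u)"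
    using fS fcls sym by (rule sum_deg_in_swap)
  finally have "10 * card R \<le> 5 * (\<Sum>u\<in>cls S c i0. deg_in E S u)" by linarith
  also have "\<dots> \<le> 5 * load (cls S c i0) + (2 * k + 5 * d) * card (cls S c i0)"
    using S by (intro sum_deg_le) (auto simp: cls_def)
  also have "\<dots> \<le> (2 * n + 5 * D) + (2 * k + 5 * d) * q"
    using adm i0 q(2) by (intro add_mono mult_le_mono2) (auto simp: admissible_def)
  finally have R: "10 * card R \<le> 2 * n + 5 * D + (2 * k + 5 * d) * q" .

  \<comment> \<open>Classes in \<open>L\<close> are not overweight, so \<open>Z\<close> and
    \<open>M\<close> are disjoint and their weights together stay within the total
    \<open>d * n\<close>.\<close>
  define Z where "Z = (\<Union>i\<in>H. {x \<in> cls S c i. big x})"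
  have "2 * n * card H \<le> (\<Sum>i\<in>H. 5 * load (cls S c i))"
    by (rule mult_card_le_sum) (use fin in \<open>auto simp: H_def\<close>)
  also have "\<dots> = 5 * sum fwd Z"
    unfolding load_def Z_def using fin fcls
    by (subst sum.UNION_disjoint)
      (simp_all add: sum_distrib_left, auto simp: cls_def)
  finally have HZ: "2 * n * card H \<le> 5 * sum fwd Z" .
  have "2 * k * card M \<le> (\<Sum>x\<in>M. 5 * fwd x)"
    by (rule mult_card_le_sum) (use fin in \<open>auto simp: M_def\<close>)
  then have MZ: "2 * k * card M \<le> 5 * sum fwd M" by (simp add: sum_distrib_left)
  have "finite Z" using fin fcls by (auto simp: Z_def)
  moreover have "Z \<inter> M = {}" by (auto simp: Z_def M_def U_def L H_def cls_def)
  ultimately have "sum fwd Z + sum fwd M = sum fwd (Z \<union> M)"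
    using fin by (simp add: sum.union_disjoint)
  also have "\<dots> \<le> sum fwd V"
    using S finite_V by (intro sum_mono2) (auto simp: Z_def M_def U_def cls_def)
  also have "\<dots> \<le> d * n" by (rule sum_fwd_le)
  finally have budget: "2 * n * card H + 2 * k * card M \<le> 5 * d * n" using HZ MZ by linarith

  \<comment> \<open>The budget weighs \<open>card H\<close> by \<open>n\<close> and
    \<open>card M\<close> by \<open>k\<close>, while the final count needs the ratio
    \<open>q + 1\<close> to 1. If \<open>n\<close> is at least (q + 1)k, the \<open>H\<close> term
    is lowered to that ratio; otherwise the \<open>M\<close> term is raised to it, after scaling the
    budget by \<open>q + 1\<close>.\<close>
  have HM: "2 * ((q + 1) * card H + card M) \<le> 5 * (q + 2) * d"
  proof (cases "(q + 1) * k \<le> n")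
    case True
    have "k * (2 * ((q + 1) * card H + card M)) = 2 * ((q + 1) * k) * card H + 2 * k * card M"
      by (simp add: algebra_simps)
    also have "\<dots> \<le> 2 * n * card H + 2 * k * card M" using True by simp
    also have "\<dots> \<le> 5 * d * n" by (rule budget)
    also have "\<dots> \<le> 5 * d * ((q + 2) * k)" using q(3) by (rule mult_le_mono2)
    also have "\<dots> = k * (5 * (q + 2) * d)" by (simp only: ac_simps)
    finally show ?thesis using k_pos by (simp only: mult_le_cancel1)
  next
    case False
    have "n * (2 * ((q + 1) * card H + card M)) = (q + 1) * (2 * n * card H) + 2 * n * card M"
      by (simp add: algebra_simps)
    also have "\<dots> \<le> (q + 1) * (2 * n * card H) + 2 * ((q + 1) * k) * card M"
      using False by simp
    also have "\<dots> = (q + 1) * (2 * n * card H + 2 * k * card M)"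
      by (simp add: algebra_simps)
    also have "\<dots> \<le> (q + 1) * (5 * d * n)" using budget by (rule mult_le_mono2)
    also have "\<dots> \<le> (q + 2) * (5 * d * n)" by simp
    also have "\<dots> = n * (5 * (q + 2) * d)" by (simp only: ac_simps)
    finally show ?thesis using n_pos by (simp only: mult_le_cancel1)
  qed

  \<comment> \<open>Ten times the covering inequality. The bound on \<open>R\<close> contributes 4(q
    + 1)k on the right, so 6(q + 1)k remains on the left, in conflict with
    \<open>room\<close>.\<close>
  have "(q + 1) * k \<le> (q + 1) * (card L + card B + card H)"
    using cover by (rule mult_le_mono2)
  moreover have "(q + 1) * (2 * card B) \<le> (q + 1) * d"
    using B by (rule mult_le_mono2)
  ultimately have "10 * ((q + 1) * k) \<le> 5 * (5 * (q + 2) * d)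
      + (2 * ((q + 2) * k) + 5 * D + (2 * k + 5 * d) * q) + 5 * ((q + 1) * d)"
    using L_le R HM q(3) by (simp only: distrib_left)
  then have "6 * (q + 1) * k \<le> 5 * ((7 * q + 11) * d + D)"
    by (simp add: algebra_simps)
  then show False using room[OF q(1,3)] by linarith
qed

text \<open>Here \<open>t\<close> is the capacity: classes with fewer than \<open>t\<close> vertices
  are not full. Even when the colouring is rearranged, exactly one class changes its size, and that
  class was not full. The exchange uses \<open>movable_exists\<close> with
  \<open>q = t - 1\<close>.\<close>

lemma admissible_insert:
  assumes S: "S \<subseteq> V" and adm: "admissible S c" and v: "v \<in> V" "v \<notin> S" "deg_in E S v \<le> d"
    and t: "\<exists>i\<in>{1..k}. card (cls S c i) < t" "n \<le> (t + 1) * k"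
  shows "\<exists>c' j. admissible (insert v S) c' \<and> j \<in> {1..k} \<and> card (cls S c j) < t \<and>
           (\<forall>i. card (cls (insert v S) c' i) = card (cls S c i) + (if i = j then 1 else 0))"
proof -
  have fS: "finite S" using S finite_V by (rule finite_subset)
  have fcls: "finite (cls S c i)" for i using fS by (simp add: cls_def)
  have range: "c ` S \<subseteq> {1..k}" using adm by (simp add: admissible_def)
  have sp: "sparse E 1 (cls S c i)" and ld: "5 * load (cls S c i) \<le> 2 * n + 5 * D"
    if "i \<in> {1..k}" for i using adm that by (auto simp: admissible_def)
  define L where
    "L = {i \<in> {1..k}. deg_in E (cls S c i) v \<le> 1 \<and> 5 * load (cls S c i) \<le> 2 * n}"
  show ?thesis
  proof (cases "\<exists>j\<in>L. card (cls S c j) < t")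
    case True
    then obtain j where j: "j \<in> L" "card (cls S c j) < t" by auto
    define c' where "c' = c(v := j)"
    have cls': "cls (insert v S) c' i = (if i = j then insert v (cls S c i) else cls S c i)" for i
      using v(2) by (auto simp: cls_def c'_def)
    have jk: "j \<in> {1..k}" using j by (simp add: L_def)
    have "sparse E 1 (insert v (cls S c j))"
      using fcls sp[OF jk] j(1) irrefl by (intro sparse_insert) (auto simp: L_def)
    moreover have "5 * load (insert v (cls S c j)) \<le> 2 * n + 5 * D"
      using load_insert_le[OF fcls v(1), of j] j(1) by (auto simp: L_def)
    moreover have "c' ` insert v S \<subseteq> {1..k}" using range jk by (auto simp: c'_def)
    ultimately have "admissible (insert v S) c'"
      using sp ld by (auto simp: admissible_def cls')
    moreover have "card (cls (insert v S) c' i) = card (cls S c i) + (if i = j then 1 else 0)" for i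
      using fcls[of i] v(2) by (auto simp: cls' card_insert_if) (auto simp: cls_def)
    ultimately show ?thesis using jk j(2) by blast
  next
    case False
    obtain i0 where i0: "i0 \<in> {1..k}" "card (cls S c i0) < t" using t(1) by auto
    have i0L: "i0 \<notin> L" using False i0 by auto
    \<comment> \<open>An empty class would accept \<open>v\<close>, so class \<open>i0\<close> is
      nonempty. Hence \<open>t\<close> is at least 2, which supplies the condition
      \<open>1 \<le> q\<close> of \<open>room\<close>.\<close>
    have "cls S c i0 \<noteq> {}"
    proof
      assume "cls S c i0 = {}"
      then have "i0 \<in> L" using i0(1) by (simp add: L_def deg_in_def load_def)
      then show False using i0L by simp
    qed
    then have "0 < card (cls S c i0)" using fcls[of i0] by (simp add: card_gt_0_iff)
    then have q: "1 \<le> t - 1" "card (cls S c i0) \<le> t - 1" "t - 1 + 2 = t + 1" "t - 1 + 1 = t"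
      using i0(2) by auto
    have n_pos: "0 < n" using v(1) finite_V by (auto simp: card_gt_0_iff)
    obtain j x where j: "j \<in> L" "x \<in> cls S c j" "\<not> big x" "deg_in E (cls S c i0) x \<le> 1"
      using movable_exists[OF S adm i0(1) q(1,2) _ v(3) n_pos L_def] False t(2)
      unfolding q(3,4) by force
    have jk: "j \<in> {1..k}" using j by (simp add: L_def)
    have ji0: "j \<noteq> i0" using j i0L by auto
    have x: "x \<in> S" "c x = j" "x \<noteq> v" using j v(2) by (auto simp: cls_def)
    \<comment> \<open>Class \<open>i0\<close> may already have load above 2n/5, but \<open>x\<close>
      is not big and adds nothing to it. Class \<open>j\<close> receives the possibly big
      \<open>v\<close>, and its load was at most 2n/5.\<close>
    define c' where "c' = c(v := j, x := i0)"
    have cls': "cls (insert v S) c' i = (if i = i0 then insert x (cls S c i)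
        else if i = j then insert v (cls S c i - {x}) else cls S c i)" for i
      using v(2) x ji0 by (auto simp: cls_def c'_def)
    have "deg_in E (cls S c j - {x}) v \<le> deg_in E (cls S c j) v"
      using fcls by (intro deg_in_mono) auto
    then have "sparse E 1 (insert v (cls S c j - {x}))"
      using fcls sp[OF jk] j(1) irrefl
      by (intro sparse_insert) (auto simp: L_def intro: sparse_subset)
    moreover have "load (cls S c j - {x}) \<le> load (cls S c j)"
      using fcls by (intro load_mono) auto
    then have "5 * load (insert v (cls S c j - {x})) \<le> 2 * n + 5 * D"
      using load_insert_le[OF _ v(1), of "cls S c j - {x}"] fcls[of j] j(1) by (auto simp: L_def)
    moreover have "sparse E 1 (insert x (cls S c i0))"
      using fcls sp[OF i0(1)] j(4) irrefl by (intro sparse_insert) auto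
    moreover have "5 * load (insert x (cls S c i0)) \<le> 2 * n + 5 * D"
      using load_insert_small[OF j(3)] ld[OF i0(1)] by simp
    moreover have "c' ` insert v S \<subseteq> {1..k}" using range jk i0(1) by (auto simp: c'_def)
    ultimately have "admissible (insert v S) c'"
      using sp ld by (auto simp: admissible_def cls')
    moreover have "card (cls (insert v S) c' i) = card (cls S c i) + (if i = i0 then 1 else 0)" for i
    proof -
      have "x \<notin> cls S c i0" "v \<notin> cls S c j" using x ji0 v(2) by (auto simp: cls_def)
      moreover have "Suc (card (cls S c j - {x})) = card (cls S c j)"
        using j(2) fcls by (intro card_Suc_Diff1)
      ultimately show ?thesis using fcls ji0 by (auto simp: cls')
    qed
    ultimately show ?thesis using i0 by blast
  qed
qed

section \<open>Controlling the class sizes\<close>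

lemma equitable_coloring_exists:
  "\<exists>c. c ` V \<subseteq> {1..k} \<and> (\<forall>i\<in>{1..k}. sparse E 1 (cls V c i)) \<and>
     (\<forall>i\<in>{1..k}. card (cls V c i) \<in> {n div k, n div k + 1})"
proof -
  define p r where "p = n div k" and "r = n mod k"
  have n: "n = p * k + r" "r < k" using k_pos by (auto simp: p_def r_def)
  define S where "S m = {v \<in> V. rank v < m}" for m
  \<comment> \<open>At most \<open>r\<close> classes may grow to size \<open>p + 1\<close>, but which ones is left open: with capacities
      fixed in advance, a non-full class could be as large as a full one.\<close>
  define excess where "excess T c = (\<Sum>i\<in>{1..k}. card (cls T c i) - p)" for T :: "'a set" and c
  have partial: "\<exists>c. admissible (S m) c \<and> (\<forall>i\<in>{1..k}. card (cls (S m) c i) \<le> p + 1) \<and> excess (S m) c \<le> r"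
    if "m \<le> n" for m
    using that
  proof (induction m)
    case 0
    have "S 0 = {}" by (simp add: S_def)
    then have "cls (S 0) c i = {}" for c i by (simp add: cls_def)
    then show ?case
      by (intro exI[of _ "\<lambda>_. 1"])
        (use \<open>S 0 = {}\<close> in \<open>auto simp: admissible_def excess_def load_def sparse_def\<close>)
  next
    case (Suc m)
    then obtain c where c: "admissible (S m) c" "\<And>i. i \<in> {1..k} \<Longrightarrow> card (cls (S m) c i) \<le> p + 1"
        "excess (S m) c \<le> r" by auto
    have "m \<in> rank ` V" using rank_bij Suc.prems by (auto simp: bij_betw_def)
    then obtain v where v: "v \<in> V" "rank v = m" by auto
    have "w = v" if "w \<in> V" "rank w = m" for w
      using inj_onD[OF bij_betw_imp_inj_on[OF rank_bij], of w v] that v by simp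
    then have S_Suc: "S (Suc m) = insert v (S m)"
      unfolding S_def using v by (fastforce simp: less_Suc_eq)
    have vS: "v \<notin> S m" using v by (simp add: S_def)
    have dv: "deg_in E (S m) v \<le> d" using back_deg[OF v(1)] v(2) by (simp add: S_def)
    have S_sub: "S m \<subseteq> V" by (auto simp: S_def)
    have fS: "finite (S m)" using S_sub finite_V by (rule finite_subset)
    have "S m \<subset> V" using S_sub v(1) vS by auto
    then have "card (S m) < n" using finite_V by (intro psubset_card_mono)
    then have total: "(\<Sum>i\<in>{1..k}. card (cls (S m) c i)) < n"
      using sum_card_cls[OF fS, of c k] c(1) by (simp add: admissible_def)
    \<comment> \<open>With capacity \<open>p + 1\<close> the excess may rise by one, which is
      allowed only while it is below \<open>r\<close>. With capacity \<open>p\<close> the growing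
      class ends with at most \<open>p\<close> vertices, so the excess stays the same.\<close>
    define t where "t = (if excess (S m) c < r then p + 1 else p)"
    \<comment> \<open>If all classes were full, they would hold at least (p + 1)k vertices in the
      first case and at least pk + r in the second. Both are at least \<open>n\<close>, but
      \<open>v\<close> is still uncoloured.\<close>
    have "\<exists>i\<in>{1..k}. card (cls (S m) c i) < t"
    proof (rule ccontr)
      assume "\<not> ?thesis"
      then have ge: "\<And>i. i \<in> {1..k} \<Longrightarrow> t \<le> card (cls (S m) c i)" by force
      show False
      proof (cases "excess (S m) c < r")
        case True
        have "(p + 1) * card {1..k} \<le> (\<Sum>i\<in>{1..k}. card (cls (S m) c i))"
          by (rule mult_card_le_sum) (use ge True in \<open>auto simp: t_def\<close>)
        then show False using total n by simp
      next
        case False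
        have "(\<Sum>i\<in>{1..k}. card (cls (S m) c i)) = (\<Sum>i\<in>{1..k}. p + (card (cls (S m) c i) - p))"
          using ge False by (intro sum.cong) (auto simp: t_def)
        also have "\<dots> = p * k + excess (S m) c" by (simp add: sum.distrib excess_def)
        finally show False using total n False by simp
      qed
    qed
    moreover have "n \<le> (t + 1) * k" using n by (auto simp: t_def algebra_simps)
    ultimately obtain c' j where c': "admissible (S (Suc m)) c'" "j \<in> {1..k}"
        "card (cls (S m) c j) < t"
        "\<And>i. card (cls (S (Suc m)) c' i) = card (cls (S m) c i) + (if i = j then 1 else 0)"
      using admissible_insert[OF S_sub c(1) v(1) vS dv] unfolding S_Suc by blast
    have "card (cls (S (Suc m)) c' i) \<le> p + 1" if "i \<in> {1..k}" for i
      using c(2)[OF that] c'(3,4) by (auto simp: t_def split: if_splits)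
    moreover have "excess (S (Suc m)) c' \<le> r"
    proof (cases "excess (S m) c < r")
      case True
      have "excess (S (Suc m)) c' \<le> (\<Sum>i\<in>{1..k}. (card (cls (S m) c i) - p) + (if i = j then 1 else 0))"
        unfolding excess_def c'(4) by (intro sum_mono) auto
      also have "\<dots> = excess (S m) c + 1" using c'(2) by (simp add: sum.distrib excess_def)
      finally show ?thesis using True by linarith
    next
      case False
      have "excess (S (Suc m)) c' = excess (S m) c"
        unfolding excess_def c'(4) using c'(3) False by (intro sum.cong) (auto simp: t_def)
      then show ?thesis using c(3) by simp
    qed
    ultimately show ?case using c'(1) by blast
  qed
  obtain c where c: "admissible (S n) c" "\<And>i. i \<in> {1..k} \<Longrightarrow> card (cls (S n) c i) \<le> p + 1"
      "excess (S n) c \<le> r" using partial[OF order_refl] by blast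
  have S_n: "S n = V" using bij_betwE[OF rank_bij] by (auto simp: S_def)
  note c = c[unfolded S_n]
  \<comment> \<open>Truncated subtraction gives a class below \<open>p\<close> the value
    \<open>p\<close> in the sum, strictly more than its size. The total n would then be less than pk
    + r.\<close>
  have "p \<le> card (cls V c j)" if j: "j \<in> {1..k}" for j
  proof (rule ccontr)
    assume less: "\<not> p \<le> card (cls V c j)"
    have "n = (\<Sum>i\<in>{1..k}. card (cls V c i))"
      using sum_card_cls[OF finite_V, of c k] c(1) by (simp add: admissible_def)
    also have "\<dots> < (\<Sum>i\<in>{1..k}. p + (card (cls V c i) - p))"
      using j less by (intro sum_strict_mono_ex1) (auto intro!: bexI[of _ j])
    also have "\<dots> = p * k + excess V c" by (simp add: sum.distrib excess_def)
    finally show False using c(3) n by linarith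
  qed
  then have "card (cls V c i) \<in> {p, p + 1}" if "i \<in> {1..k}" for i
    using c(2)[OF that] that by (fastforce simp: le_Suc_eq)
  then show ?thesis
    using c(1) unfolding admissible_def p_def by blast
qed

end

section \<open>Transfer between the digraphs of the library and sparse sets\<close>

text \<open>On a cycle of length at least 3 every vertex has two distinct neighbours on the cycle,
  so its vertex set violates sparsity.\<close>

lemma sparse_1_imp_undirected_forest:
  assumes sym: "\<And>u v. (u, v) \<in> parcs G \<Longrightarrow> (v, u) \<in> parcs G" and fin: "finite X"
    and sp: "sparse (\<lambda>u v. (u, v) \<in> parcs G) 1 X"
  shows "undirected_forest (with_proj G \<restriction> X)"
  unfolding undirected_forest_def
proof (intro notI, elim exE conjE)
  fix p assume cyc: "pre_digraph.cycle (with_proj G \<restriction> X) p" and len: "3 \<le> length p"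
  let ?H = "with_proj G \<restriction> X"
  obtain u where aw: "pre_digraph.awalk ?H u p u" and
    dist: "distinct (tl (pre_digraph.awalk_verts ?H u p))" and ne: "p \<noteq> []"
    using cyc unfolding pre_digraph.cycle_def by blast
  have arcs: "set p \<subseteq> parcs G" "set p \<subseteq> X \<times> X" and cas: "pre_digraph.cas ?H u p u"
    using aw unfolding pre_digraph.awalk_def by auto
  have verts: "pre_digraph.awalk_verts ?H u p = u # map snd p"
    using pre_digraph.awalk_verts_conv'[OF cas] pre_digraph.cas_simp[OF ne, of ?H u u] cas ne by auto
  have verts': "u # map snd p = map fst p @ [snd (last p)]"
    using pre_digraph.awalk_verts_conv[of ?H u p] ne verts by simp
  define l where "l = length p"
  \<comment> \<open>The vertices of the cycle, repeated periodically, so that the arcs from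
    \<open>h i\<close> to \<open>h (Suc i)\<close> need no separate case at the wrap-around.\<close>
  define h where "h i = snd (p ! (i mod l))" for i
  have l: "3 \<le> l" using len by (simp add: l_def)
  have dist_h: "h i = h j \<longleftrightarrow> i mod l = j mod l" for i j
  proof -
    have "distinct (map snd p)" using dist verts by simp
    moreover have "i mod l < l" "j mod l < l" using l by auto
    ultimately show ?thesis unfolding h_def using nth_eq_iff_index_eq[of "map snd p" "i mod l" "j mod l"]
      by (simp add: l_def)
  qed
  \<comment> \<open>Inside the list consecutive arcs share a vertex; at the wrap-around they meet
    because the walk is closed at \<open>u\<close>.\<close>
  have fst_nth: "fst (p ! (Suc i mod l)) = h i" for i
  proof (cases "Suc (i mod l) < l")
    case True
    then have "fst (p ! Suc (i mod l)) = (u # map snd p) ! Suc (i mod l)"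
      unfolding verts' by (simp add: nth_append l_def)
    then show ?thesis using True by (simp add: h_def mod_Suc l_def)
  next
    case False
    have "i mod l < l" using l by auto
    then have eq: "Suc (i mod l) = l" using False by linarith
    have "fst (p ! 0) = u"
      using verts' ne by (cases p) auto
    moreover have "pre_digraph.cas ?H w p z \<Longrightarrow> p \<noteq> [] \<Longrightarrow> snd (last p) = z" for w z
      by (induct p arbitrary: w) (auto simp: pre_digraph.cas.simps)
    then have "u = snd (last p)" using cas ne by blast
    moreover have "i mod l = length p - 1" using eq by (simp add: l_def)
    then have "last p = p ! (i mod l)" using ne by (simp add: last_conv_nth)
    ultimately show ?thesis using eq by (simp add: h_def mod_Suc)
  qed
  have in_p: "p ! (i mod l) \<in> set p" for i
    using l by (intro nth_mem) (auto simp flip: l_def)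
  have arc: "(h i, h (Suc i)) \<in> parcs G" and hX: "h i \<in> X" for i
  proof -
    have "p ! (Suc i mod l) = (h i, h (Suc i))"
      using fst_nth[of i] by (simp add: h_def prod_eq_iff)
    then show "(h i, h (Suc i)) \<in> parcs G" "h i \<in> X" using in_p[of "Suc i"] arcs by auto
  qed
  define T where "T = range h"
  have T: "T \<subseteq> X" "T \<noteq> {}" using hX by (auto simp: T_def)
  then obtain w where w: "w \<in> T" "deg_in (\<lambda>u v. (u, v) \<in> parcs G) T w \<le> 1"
    using sp unfolding sparse_def by blast
  then obtain j where j: "w = h j" by (auto simp: T_def)
  \<comment> \<open>the predecessor \<open>j - 1\<close> modulo \<open>l\<close>, avoiding truncated subtraction at \<open>j = 0\<close>\<close>
  define i where "i = j + l - 1"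
  have wi: "w = h (Suc i)"
    using l j by (simp add: dist_h i_def)
  \<comment> \<open>Equality would make \<open>l\<close> divide 2; this is where length at least 3
    enters.\<close>
  have neighbours: "h i \<noteq> h (Suc (Suc i))"
  proof
    assume "h i = h (Suc (Suc i))"
    then have "Suc (Suc i) mod l = i mod l" by (simp add: dist_h)
    then have "l dvd Suc (Suc i) - i" by (metis le_SucI le_refl mod_eq_dvd_iff_nat)
    then have "l \<le> 2" by (intro dvd_imp_le) auto
    then show False using l by simp
  qed
  have "{h i, h (Suc (Suc i))} \<subseteq> {x \<in> T. (w, x) \<in> parcs G}"
    using arc[of i] arc[of "Suc i"] sym wi by (auto simp: T_def)
  moreover have "finite T" using T(1) fin by (rule finite_subset)
  ultimately have "card {h i, h (Suc (Suc i))} \<le> deg_in (\<lambda>u v. (u, v) \<in> parcs G) T w"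
    unfolding deg_in_def by (intro card_mono) auto
  then show False using neighbours w(2) by simp
qed

lemma out_degree_eq_deg_in:
  assumes "pair_graph G"
  shows "out_degree (with_proj G) v = deg_in (\<lambda>u v. (u, v) \<in> parcs G) (pverts G) v"
proof -
  interpret pair_graph G by fact
  have "out_arcs (with_proj G) v = (\<lambda>u. (v, u)) ` {u \<in> pverts G. (v, u) \<in> parcs G}"
    by (auto simp: out_arcs_def image_iff in_arcsD2)
  then show ?thesis unfolding out_degree_def deg_in_def
    by (simp add: card_image inj_on_def)
qed

text \<open>Degeneracy is applied to the subgraph induced by \<open>T\<close>, which inherits
  symmetry and whose degrees are the numbers of neighbours in \<open>T\<close>.\<close>

lemma degenerate_imp_sparse:
  assumes "pair_graph G" "degenerate d G"
  shows "sparse (\<lambda>u v. (u, v) \<in> parcs G) d (pverts G)"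
  unfolding sparse_def
proof (intro allI impI)
  interpret pair_graph G by fact
  fix T assume T: "T \<subseteq> pverts G" "T \<noteq> {}"
  define H where "H = \<lparr>pverts = T, parcs = {e \<in> parcs G. fst e \<in> T \<and> snd e \<in> T}\<rparr>"
  have "finite T" using T pair_finite_verts by (auto intro: finite_subset)
  have H: "pair_graph H"
  proof
    show "finite (pverts H)" "finite (parcs H)"
      using \<open>finite T\<close> pair_finite_arcs by (auto simp: H_def)
    show "symmetric (with_proj H)"
      using pair_sym_arcs by (auto simp: symmetric_def sym_def H_def)
  qed (auto simp: H_def dest: no_loops')
  have "subgraph (with_proj H) (with_proj G)"
    unfolding subgraph_def
  proof (intro conjI)
    show "wf_digraph (with_proj H)"
      using H by (simp add: wf_digraph_wp_iff pair_graph_def pair_digraph_def pair_fin_digraph_def)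
  qed (use T in \<open>auto simp: H_def compatible_def intro: wf_digraph_axioms\<close>)
  moreover have "pverts H = T" by (simp add: H_def)
  ultimately obtain v where v: "v \<in> T" "out_degree (with_proj H) v \<le> d"
    using assms(2) H T(2) unfolding degenerate_def by blast
  have "deg_in (\<lambda>u v. (u, v) \<in> parcs H) T v = deg_in (\<lambda>u v. (u, v) \<in> parcs G) T v"
    unfolding deg_in_def by (rule arg_cong[where f = card]) (use v(1) in \<open>auto simp: H_def\<close>)
  then have "deg_in (\<lambda>u v. (u, v) \<in> parcs G) T v \<le> d"
    using v(2) out_degree_eq_deg_in[OF H] by (simp add: H_def)
  then show "\<exists>v\<in>T. deg_in (\<lambda>u v. (u, v) \<in> parcs G) T v \<le> d" using v(1) by blast
qed

theorem theorem1:
  fixes G :: "'a pair_pre_digraph"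
    and \<alpha> \<beta> d \<Delta> k :: nat
  assumes "(\<alpha>, \<beta>) \<in> {(8, 56), (9, 26), (10, 18), (11, 15), (12, 13), (13, 12),
                      (14, 11), (15, 10), (17, 9), (20, 8), (27, 7), (52, 6)}"
    and "d \<ge> 1"
    and "pair_graph G"
    and "degenerate d G"
    and "\<forall>v\<in>pverts G. out_degree (with_proj G) v \<le> \<Delta>"
    and "card (pverts G) \<ge> \<beta> * \<Delta>"
    and "k \<ge> \<alpha> * d"
  shows "\<exists>c. equitable_tree_coloring G k c"
proof -
  interpret pair_graph G by fact
  let ?V = "pverts G" and ?E = "\<lambda>u v. (u, v) \<in> parcs G"
  have sym: "(v, u) \<in> parcs G" if "(u, v) \<in> parcs G" for u v
    using pair_sym_arcs that by (auto simp: symmetric_def dest: symD)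
  obtain rank where rank: "bij_betw rank ?V {..<card ?V}"
      "\<And>v. v \<in> ?V \<Longrightarrow> deg_in ?E {u \<in> ?V. rank u < rank v} v \<le> d"
    using sparse_imp_rank[OF pair_finite_verts degenerate_imp_sparse[OF assms(3,4)]] by blast
  \<comment> \<open>All pairs except the first two satisfy \<open>\<alpha> \<ge> 10\<close> and \<open>\<beta> \<ge> 6\<close>, and that suffices.\<close>
  have params: "(8 * d \<le> k \<and> 56 * \<Delta> \<le> card ?V) \<or> (9 * d \<le> k \<and> 26 * \<Delta> \<le> card ?V)
      \<or> (10 * d \<le> k \<and> 6 * \<Delta> \<le> card ?V)"
    using assms(1,6,7) by (elim insertE) auto
  have k_pos: "0 < k" using params assms(2) by auto
  interpret ranked_graph ?V ?E rank d k \<Delta>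
  proof
    fix q :: nat assume q: "1 \<le> q" "card ?V \<le> (q + 2) * k"
    \<comment> \<open>Writing \<open>q\<close> as \<open>Suc q'\<close> and naming the products
      \<open>x\<close> and \<open>y\<close> makes \<open>room\<close> a linear inequality. The bound
      on \<open>\<Delta>\<close> enters through \<open>card ?V \<le> (q + 2) * k\<close>, and
      \<open>scale\<close> carries the bound on \<open>d\<close> over to \<open>y\<close>.\<close>
    obtain q' where q': "q = Suc q'" using q(1) by (cases q) auto
    define x y where "x = q' * k" and "y = q' * d"
    have expand: "(q + 2) * k = 3 * k + x" "(7 * q + 11) * d = 18 * d + 7 * y"
      "6 * (q + 1) * k = 12 * k + 6 * x"
      by (simp_all add: q' x_def y_def algebra_simps)
    have scale: "a * y \<le> x" if "a * d \<le> k" for a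
      using mult_le_mono2[OF that, of q'] by (simp only: x_def y_def ac_simps)
    show "5 * ((7 * q + 11) * d + \<Delta>) < 6 * (q + 1) * k"
      using params
    proof (elim disjE conjE)
      assume "8 * d \<le> k" "56 * \<Delta> \<le> card ?V"
      then show ?thesis using scale[OF \<open>8 * d \<le> k\<close>] q(2)[unfolded expand] k_pos
        unfolding expand by simp
    next
      assume "9 * d \<le> k" "26 * \<Delta> \<le> card ?V"
      then show ?thesis using scale[OF \<open>9 * d \<le> k\<close>] q(2)[unfolded expand] k_pos
        unfolding expand by simp
    next
      assume "10 * d \<le> k" "6 * \<Delta> \<le> card ?V"
      then show ?thesis using scale[OF \<open>10 * d \<le> k\<close>] q(2)[unfolded expand] k_pos
        unfolding expand by simp
    qed
  next
    show "deg_in ?E ?V v \<le> \<Delta>" if "v \<in> ?V" for v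
      using assms(5) that by (simp add: out_degree_eq_deg_in[OF assms(3)])
    show "(v, v) \<notin> parcs G" for v using no_loops'[of v v] by blast
  qed (use rank k_pos pair_finite_verts sym in auto)
  obtain c where c: "c ` ?V \<subseteq> {1..k}" "\<And>i. i \<in> {1..k} \<Longrightarrow> sparse ?E 1 (cls ?V c i)"
      "\<And>i. i \<in> {1..k} \<Longrightarrow> card (cls ?V c i) \<in> {card ?V div k, card ?V div k + 1}"
    using equitable_coloring_exists by blast
  have cls: "color_class G c i = cls ?V c i" for i by (simp add: color_class_def cls_def)
  have "undirected_forest (with_proj G \<restriction> color_class G c i)" if "i \<in> {1..k}" for i
    unfolding cls using c(2)[OF that] sym pair_finite_verts
    by (intro sparse_1_imp_undirected_forest) (auto simp: cls_def)
  moreover have "\<bar>int (card (color_class G c i)) - int (card (color_class G c j))\<bar> \<le> 1"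
    if "i \<in> {1..k}" "j \<in> {1..k}" for i j
    unfolding cls using c(3)[OF that(1)] c(3)[OF that(2)] by auto
  ultimately have "equitable_tree_coloring G k c"
    using c(1) unfolding equitable_tree_coloring_def tree_coloring_def by blast
  then show ?thesis by blast
qed

end
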